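(* Let $a\in L^1(I)$ and $\lambda\in\mathbb{R}$. If the operator $L[\lambda]$ is nonresonant in $X_D$ and in $X_N$, then for all $(t,s)\in I\times I$ $$G_D[\lambda](t,s)=G_N[\lambda](t,s)+r_5[\lambda](t)\,\frac{\partial}{\partial t}G_D[\lambda](0,s)+r_6[\lambda](t)\,\frac{\partial}{\partial t}G_D[\lambda](1,s)$$ $$=G_N[\lambda](t,s)+G_N[\lambda](t,0)\,\frac{\partial}{\partial t}G_D[\lambda](0,s)-G_N[\lambda](t,1)\,\frac{\partial}{\partial t}G_D[\lambda](1,s).$$
   Context: $I=[0,1]$, $a\in L^1(I)$ is real-valued, $\lambda\in\mathbb{R}$, and $L[\lambda]u(t)=u''(t)+(a(t)+\lambda)u(t)$. $W^{2,1}(I)=\{u\in C(I):u'\in AC(I)\}$, where $AC(I)$ is the set of absolutely continuous functions on $I$. $X_D=\{u\in W^{2,1}(I):u(0)=u(1)=0\}$ (Dirichlet) and $X_N=\{u\in W^{2,1}(I):u'(0)=u'(1)=0\}$ (Neumann). $L[\lambda]$ is nonresonant in $X$ if $u=0$ is the only $u\in X$ with $L[\lambda]u=0$ a.e. on $I$. In that case, for every $\sigma\in L^1(I)$ the problem $L[\lambda]u=\sigma$ a.e. on $I$, $u\in X$, has a unique solution, given by $u(t)=\int_0^1G(t,s)\sigma(s)\,ds$, where the continuous function $G:I\times I\to\mathbb{R}$ is the Green's function; it is denoted $G_D[\lambda]$ for $X=X_D$ and $G_N[\lambda]$ for $X=X_N$. $r_5[\lambda]$ is the unique solution of $L[\lambda]u=0$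 a.e. on $I$, $u'(0)=1$, $u'(1)=0$; $r_6[\lambda]$ is the unique solution of $L[\lambda]u=0$ a.e. on $I$, $u'(0)=0$, $u'(1)=1$. Convention: $\frac{\partial}{\partial t}G(0,s)$ and $\frac{\partial}{\partial t}G(1,s)$ (derivative with respect to the first variable, at $t=0$, $t=1$) are one-sided derivatives for $s\in(0,1)$, extended by continuity to $s\in\{0,1\}$. *)

theory Defs
  imports "HOL-Analysis.Analysis"
begin

text \<open>
  Functions on \<open>I = [0,1]\<close> are represented by total functions on the reals; every notion below
  depends only on their values on \<open>I\<close>.  In particular derivatives are taken within \<open>I\<close>, so that
  they are one-sided at the end points.
\<close>

definition absolutely_continuous_on_Icc :: "real \<Rightarrow> real \<Rightarrow> (real \<Rightarrow> real) \<Rightarrow> bool" where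
  "absolutely_continuous_on_Icc a b f \<longleftrightarrow>
     (\<forall>\<epsilon>>0. \<exists>\<delta>>0. \<forall>(n::nat) x y.
        (\<forall>i<n. a \<le> x i \<and> x i \<le> y i \<and> y i \<le> b) \<and>
        (\<forall>i<n. \<forall>j<n. i \<noteq> j \<longrightarrow> {x i<..<y i} \<inter> {x j<..<y j} = {}) \<and>
        (\<Sum>i<n. y i - x i) < \<delta> \<longrightarrow>
        (\<Sum>i<n. \<bar>f (y i) - f (x i)\<bar>) < \<epsilon>)"

definition deriv_I :: "(real \<Rightarrow> real) \<Rightarrow> real \<Rightarrow> real" where
  "deriv_I u t = vector_derivative u (at t within {0..1})"

definition W21 :: "(real \<Rightarrow> real) set" where
  "W21 = {u. continuous_on {0..1} u \<and> u differentiable_on {0..1} \<and>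
             absolutely_continuous_on_Icc 0 1 (deriv_I u)}"

definition X_D :: "(real \<Rightarrow> real) set" where
  "X_D = {u \<in> W21. u 0 = 0 \<and> u 1 = 0}"

definition X_N :: "(real \<Rightarrow> real) set" where
  "X_N = {u \<in> W21. deriv_I u 0 = 0 \<and> deriv_I u 1 = 0}"

text \<open>
  The equation \<open>L[lam] u = \<sigma>\<close> a.e. on \<open>I\<close>, with \<open>L[lam] u = u'' + (a + lam) u\<close>.  The second derivative
  is required to exist at almost every point, instead of being a totalised derivative.
\<close>

definition L_eq_ae :: "(real \<Rightarrow> real) \<Rightarrow> real \<Rightarrow> (real \<Rightarrow> real) \<Rightarrow> (real \<Rightarrow> real) \<Rightarrow> bool" where
  "L_eq_ae a lam u \<sigma> \<longleftrightarrow>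
     (AE t in lebesgue_on {0..1}.
        \<exists>u2. (deriv_I u has_real_derivative u2) (at t within {0..1}) \<and>
             u2 + (a t + lam) * u t = \<sigma> t)"

definition nonresonant :: "(real \<Rightarrow> real) \<Rightarrow> real \<Rightarrow> (real \<Rightarrow> real) set \<Rightarrow> bool" where
  "nonresonant a lam X \<longleftrightarrow> (\<forall>u\<in>X. L_eq_ae a lam u (\<lambda>_. 0) \<longrightarrow> (\<forall>t\<in>{0..1}. u t = 0))"

text \<open>
  Uniqueness of the solution \<open>\<integral> G(\<cdot>,s) \<sigma>(s) ds\<close> is not part of this definition: it is equivalent
  to \<open>nonresonant a lam X\<close>.  Under that condition \<open>G\<close> is determined on \<open>I \<times> I\<close>.
\<close>

definition is_Green_function ::
  "(real \<Rightarrow> real) \<Rightarrow> real \<Rightarrow> (real \<Rightarrow> real) set \<Rightarrow> (real \<Rightarrow> real \<Rightarrow> real) \<Rightarrow> bool" where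
  "is_Green_function a lam X G \<longleftrightarrow>
     continuous_on ({0..1} \<times> {0..1}) (\<lambda>(t, s). G t s) \<and>
     (\<forall>\<sigma>. integrable (lebesgue_on {0..1}) \<sigma> \<longrightarrow>
        (\<lambda>t. LINT s|lebesgue_on {0..1}. G t s * \<sigma> s) \<in> X \<and>
        L_eq_ae a lam (\<lambda>t. LINT s|lebesgue_on {0..1}. G t s * \<sigma> s) \<sigma>)"

definition is_r5 :: "(real \<Rightarrow> real) \<Rightarrow> real \<Rightarrow> (real \<Rightarrow> real) \<Rightarrow> bool" where
  "is_r5 a lam r \<longleftrightarrow> r \<in> W21 \<and> L_eq_ae a lam r (\<lambda>_. 0) \<and> deriv_I r 0 = 1 \<and> deriv_I r 1 = 0"

definition is_r6 :: "(real \<Rightarrow> real) \<Rightarrow> real \<Rightarrow> (real \<Rightarrow> real) \<Rightarrow> bool" where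
  "is_r6 a lam r \<longleftrightarrow> r \<in> W21 \<and> L_eq_ae a lam r (\<lambda>_. 0) \<and> deriv_I r 0 = 0 \<and> deriv_I r 1 = 1"

text \<open>
  \<open>\<partial>G/\<partial>t (t0, s)\<close> for \<open>t0 \<in> {0,1}\<close>: the one-sided derivative when \<open>0 < s < 1\<close>, extended by
  continuity to \<open>s \<in> {0,1}\<close>.  The extension matters: \<open>G\<^sub>D(\<cdot>,0)\<close> vanishes identically, whereas
  \<open>\<partial>G\<^sub>D/\<partial>t (0, s)\<close> tends to \<open>-1\<close> as \<open>s\<close> tends to \<open>0\<close>.
\<close>

definition dt_boundary :: "(real \<Rightarrow> real \<Rightarrow> real) \<Rightarrow> real \<Rightarrow> real \<Rightarrow> real" where
  "dt_boundary G t0 s =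
     (if s \<in> {0<..<1} then deriv_I (\<lambda>t. G t s) t0
      else Lim (at s within {0<..<1}) (\<lambda>s'. deriv_I (\<lambda>t. G t s') t0))"

end

theory Submission
  imports Defs
begin

text \<open>
  Write \<open>q = a + lam\<close>.  All formulas come from the Lagrange identity: if \<open>u'' + q u = \<sigma>\<close> and \<open>w'' + q w = 0\<close>
  almost everywhere, then \<open>\<integral> \<sigma> w\<close> over \<open>[x,y]\<close> is the increment of \<open>u' w - u w'\<close> from \<open>x\<close> to \<open>y\<close>
  (\<open>Lagrange_identity\<close>).  It rests on the fundamental theorem of calculus for absolutely
  continuous functions that are differentiable almost everywhere, which is proved by a gauge argument.

  Applied to \<open>r5\<close> and \<open>r6\<close>, the identity shows that their Wronskian is the constant
  \<open>r6 0 = - r5 1\<close>, which is nonzero by uniqueness for the Cauchy problem.  Applied to an arbitrary solution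
  \<open>u\<close> of \<open>u'' + q u = \<sigma>\<close>, with \<open>r6\<close> on \<open>[0,t]\<close> and \<open>r5\<close> on \<open>[t,1]\<close>, it yields
  \<open>u t = u' 0 * r5 t + u' 1 * r6 t + \<integral> K t s * \<sigma> s\<close> with
  \<open>K t s = r6 (min t s) * r5 (max t s) / r6 0\<close> (\<open>Neumann_representation\<close>).
  For \<open>u \<in> X_N\<close> the first two terms vanish, hence \<open>K\<close> is the Neumann Green's function.
  In particular its values at \<open>s = 0\<close> and \<open>s = 1\<close> are \<open>r5 t\<close> and \<open>- r6 t\<close>, which turns the first formula
  of the theorem into the second.

  For \<open>u \<in> X_D\<close> the Lagrange identity with the homogeneous solutions \<open>\<psi>, \<phi>\<close> that have Dirichlet data
  \<open>(1,0)\<close> and \<open>(0,1)\<close> gives \<open>u' 0 = - \<integral> \<sigma> \<psi>\<close> and \<open>u' 1 = \<integral> \<sigma> \<phi>\<close>.  These solutions are combinations of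
  \<open>r5\<close> and \<open>r6\<close>, and they exist because the Dirichlet problem is nonresonant.  Inserted into the
  representation, the two integrals show that the Dirichlet Green's function is \<open>K t s - r5 t * \<psi> s + r6 t * \<phi> s\<close>.  Since \<open>K\<close> has vanishing \<open>t\<close>-derivative
  at \<open>t = 0\<close> and \<open>t = 1\<close> for \<open>0 < s < 1\<close>, the boundary derivatives of the Dirichlet Green's function are \<open>- \<psi>\<close> and \<open>\<phi>\<close>.
\<close>

section \<open>Absolutely continuous functions on an interval\<close>

lemma absolutely_continuous_on_IccE:
  assumes "absolutely_continuous_on_Icc a b f" and "\<epsilon> > 0"
  obtains \<delta> where "\<delta> > 0" and "\<And>(n::nat) x y.
      (\<forall>i<n. a \<le> x i \<and> x i \<le> y i \<and> y i \<le> b) \<and>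
      (\<forall>i<n. \<forall>j<n. i \<noteq> j \<longrightarrow> {x i<..<y i} \<inter> {x j<..<y j} = {}) \<and>
      (\<Sum>i<n. y i - x i) < \<delta> \<Longrightarrow> (\<Sum>i<n. \<bar>f (y i) - f (x i)\<bar>) < \<epsilon>"
proof -
  from assms(1)[unfolded absolutely_continuous_on_Icc_def, THEN spec, THEN mp, OF assms(2)]
  show thesis by (elim exE conjE) (rule that, assumption, elim allE, erule mp)
qed

text \<open>
  In a tagged division the intervals are indexed by the tagged intervals themselves, hence this form
  of the definition with an arbitrary finite index set in place of an initial segment of the naturals.
\<close>

lemma absolutely_continuous_on_Icc_finite:
  fixes f :: "real \<Rightarrow> real"
  assumes "absolutely_continuous_on_Icc a b f" and "\<epsilon> > 0"
  obtains \<delta> where "\<delta> > 0"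
    and "\<forall>(S :: 'i set) x y.
      finite S \<and> (\<forall>i\<in>S. a \<le> x i \<and> x i \<le> y i \<and> y i \<le> b) \<and>
      (\<forall>i\<in>S. \<forall>j\<in>S. i \<noteq> j \<longrightarrow> {x i<..<y i} \<inter> {x j<..<y j} = {}) \<and>
      (\<Sum>i\<in>S. y i - x i) < \<delta> \<longrightarrow> (\<Sum>i\<in>S. \<bar>f (y i) - f (x i)\<bar>) < \<epsilon>"
proof -
  obtain \<delta> where "\<delta> > 0" and \<delta>: "\<And>(n::nat) x y.
      (\<forall>i<n. a \<le> x i \<and> x i \<le> y i \<and> y i \<le> b) \<and>
      (\<forall>i<n. \<forall>j<n. i \<noteq> j \<longrightarrow> {x i<..<y i} \<inter> {x j<..<y j} = {}) \<and>
      (\<Sum>i<n. y i - x i) < \<delta> \<Longrightarrow> (\<Sum>i<n. \<bar>f (y i) - f (x i)\<bar>) < \<epsilon>"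
    using absolutely_continuous_on_IccE[OF assms] by blast
  show thesis
  proof (rule that[OF \<open>\<delta> > 0\<close>], intro allI impI)
    fix S :: "'i set" and x y
    assume *: "finite S \<and> (\<forall>i\<in>S. a \<le> x i \<and> x i \<le> y i \<and> y i \<le> b) \<and>
      (\<forall>i\<in>S. \<forall>j\<in>S. i \<noteq> j \<longrightarrow> {x i<..<y i} \<inter> {x j<..<y j} = {}) \<and>
      (\<Sum>i\<in>S. y i - x i) < \<delta>"
    note fin = *[THEN conjunct1]
      and ordered = *[THEN conjunct2, THEN conjunct1, rule_format]
      and disjoint = *[THEN conjunct2, THEN conjunct2, THEN conjunct1, rule_format]
      and small = *[THEN conjunct2, THEN conjunct2, THEN conjunct2]
    obtain h where h: "bij_betw h {..<card S} S"
      using ex_bij_betw_nat_finite[OF fin] by (auto simp: lessThan_atLeast0)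
    have hS: "h i \<in> S" if "i < card S" for i
      using h that by (auto simp: bij_betw_def)
    have hne: "h i \<noteq> h j" if "i < card S" "j < card S" "i \<noteq> j" for i j
      using h that by (auto simp: bij_betw_def inj_on_def)
    have "(\<Sum>i<card S. \<bar>f ((y \<circ> h) i) - f ((x \<circ> h) i)\<bar>) < \<epsilon>"
    proof (rule \<delta>, intro conjI allI impI)
      show "(\<Sum>i<card S. (y \<circ> h) i - (x \<circ> h) i) < \<delta>"
        using small sum.reindex_bij_betw[OF h, of "\<lambda>i. y i - x i"] by simp
    next
      fix i assume "i < card S"
      then show "a \<le> (x \<circ> h) i" "(x \<circ> h) i \<le> (y \<circ> h) i" "(y \<circ> h) i \<le> b"
        using ordered[OF hS] by auto
    next
      fix i j assume "i < card S" "j < card S" "i \<noteq> j"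
      then show "{(x \<circ> h) i<..<(y \<circ> h) i} \<inter> {(x \<circ> h) j<..<(y \<circ> h) j} = {}"
        using disjoint[OF hS hS hne] by simp
    qed
    then show "(\<Sum>i\<in>S. \<bar>f (y i) - f (x i)\<bar>) < \<epsilon>"
      using sum.reindex_bij_betw[OF h, of "\<lambda>i. \<bar>f (y i) - f (x i)\<bar>"] by simp
  qed
qed

lemma absolutely_continuous_on_Icc_subset:
  assumes "absolutely_continuous_on_Icc a b f" and "a \<le> c" "d \<le> b"
  shows "absolutely_continuous_on_Icc c d f"
  unfolding absolutely_continuous_on_Icc_def
proof (intro allI impI)
  fix \<epsilon> :: real assume "\<epsilon> > 0"
  then obtain \<delta> where "\<delta> > 0" and \<delta>: "\<And>(n::nat) x y.
      (\<forall>i<n. a \<le> x i \<and> x i \<le> y i \<and> y i \<le> b) \<and>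
      (\<forall>i<n. \<forall>j<n. i \<noteq> j \<longrightarrow> {x i<..<y i} \<inter> {x j<..<y j} = {}) \<and>
      (\<Sum>i<n. y i - x i) < \<delta> \<Longrightarrow> (\<Sum>i<n. \<bar>f (y i) - f (x i)\<bar>) < \<epsilon>"
    using absolutely_continuous_on_IccE[OF assms(1)] by blast
  show "\<exists>\<delta>>0. \<forall>(n::nat) x y.
      (\<forall>i<n. c \<le> x i \<and> x i \<le> y i \<and> y i \<le> d) \<and>
      (\<forall>i<n. \<forall>j<n. i \<noteq> j \<longrightarrow> {x i<..<y i} \<inter> {x j<..<y j} = {}) \<and>
      (\<Sum>i<n. y i - x i) < \<delta> \<longrightarrow> (\<Sum>i<n. \<bar>f (y i) - f (x i)\<bar>) < \<epsilon>"
  proof (intro exI[of _ \<delta>] conjI \<open>\<delta> > 0\<close> allI impI)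
    fix n :: nat and x y :: "nat \<Rightarrow> real"
    assume *: "(\<forall>i<n. c \<le> x i \<and> x i \<le> y i \<and> y i \<le> d) \<and>
      (\<forall>i<n. \<forall>j<n. i \<noteq> j \<longrightarrow> {x i<..<y i} \<inter> {x j<..<y j} = {}) \<and> (\<Sum>i<n. y i - x i) < \<delta>"
    then have "\<forall>i<n. a \<le> x i \<and> x i \<le> y i \<and> y i \<le> b"
      using assms(2,3) by fastforce
    with * show "(\<Sum>i<n. \<bar>f (y i) - f (x i)\<bar>) < \<epsilon>"
      by (intro \<delta>) blast
  qed
qed

lemma absolutely_continuous_on_Icc_imp_continuous_on:
  assumes "absolutely_continuous_on_Icc a b f"
  shows "continuous_on {a..b} f"
  unfolding continuous_on_iff
proof (intro ballI allI impI)
  fix t \<epsilon> :: real assume t: "t \<in> {a..b}" and "0 < \<epsilon>"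
  obtain \<delta> where "\<delta> > 0" and \<delta>: "\<forall>(S :: unit set) x y.
      finite S \<and> (\<forall>i\<in>S. a \<le> x i \<and> x i \<le> y i \<and> y i \<le> b) \<and>
      (\<forall>i\<in>S. \<forall>j\<in>S. i \<noteq> j \<longrightarrow> {x i<..<y i} \<inter> {x j<..<y j} = {}) \<and>
      (\<Sum>i\<in>S. y i - x i) < \<delta> \<longrightarrow> (\<Sum>i\<in>S. \<bar>f (y i) - f (x i)\<bar>) < \<epsilon>"
    by (rule absolutely_continuous_on_Icc_finite[OF assms \<open>0 < \<epsilon>\<close>, where 'i = unit])
  show "\<exists>d>0. \<forall>x'\<in>{a..b}. dist x' t < d \<longrightarrow> dist (f x') (f t) < \<epsilon>"
  proof (intro exI[of _ \<delta>] conjI \<open>\<delta> > 0\<close> ballI impI)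
    fix s assume "s \<in> {a..b}" and "dist s t < \<delta>"
    then have "\<bar>f (max s t) - f (min s t)\<bar> < \<epsilon>"
      using t \<open>s \<in> {a..b}\<close> \<delta>[rule_format, of UNIV "\<lambda>_. min s t" "\<lambda>_. max s t"]
      by (cases "s \<le> t") (simp_all add: dist_real_def)
    then show "dist (f s) (f t) < \<epsilon>"
      by (simp add: dist_real_def min_def max_def abs_minus_commute split: if_splits)
  qed
qed

text \<open>
  Absolute continuity is inherited by every function whose increments are dominated by those of
  absolutely continuous functions.  Sums, products and \<open>C\<^sup>1\<close> functions are instances.
\<close>

lemma absolutely_continuous_on_Icc_if_sums_controlled:
  assumes F: "absolutely_continuous_on_Icc a b f" and G: "absolutely_continuous_on_Icc a b g"
    and "B > 0"
    and le: "\<And>x y. \<lbrakk>a \<le> x; x \<le> y; y \<le> b\<rbrakk> \<Longrightarrow> \<bar>h y - h x\<bar> \<le> B * (\<bar>f y - f x\<bar> + \<bar>g y - g x\<bar>)"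
  shows "absolutely_continuous_on_Icc a b h"
  unfolding absolutely_continuous_on_Icc_def
proof (intro allI impI)
  fix \<epsilon> :: real assume "\<epsilon> > 0"
  then have e: "\<epsilon> / (2 * B) > 0" using \<open>B > 0\<close> by simp
  obtain \<delta>1 where "\<delta>1 > 0" and \<delta>1: "\<And>(n::nat) x y.
      (\<forall>i<n. a \<le> x i \<and> x i \<le> y i \<and> y i \<le> b) \<and>
      (\<forall>i<n. \<forall>j<n. i \<noteq> j \<longrightarrow> {x i<..<y i} \<inter> {x j<..<y j} = {}) \<and>
      (\<Sum>i<n. y i - x i) < \<delta>1 \<Longrightarrow> (\<Sum>i<n. \<bar>f (y i) - f (x i)\<bar>) < \<epsilon> / (2 * B)"
    using absolutely_continuous_on_IccE[OF F e] by blast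
  obtain \<delta>2 where "\<delta>2 > 0" and \<delta>2: "\<And>(n::nat) x y.
      (\<forall>i<n. a \<le> x i \<and> x i \<le> y i \<and> y i \<le> b) \<and>
      (\<forall>i<n. \<forall>j<n. i \<noteq> j \<longrightarrow> {x i<..<y i} \<inter> {x j<..<y j} = {}) \<and>
      (\<Sum>i<n. y i - x i) < \<delta>2 \<Longrightarrow> (\<Sum>i<n. \<bar>g (y i) - g (x i)\<bar>) < \<epsilon> / (2 * B)"
    using absolutely_continuous_on_IccE[OF G e] by blast
  show "\<exists>\<delta>>0. \<forall>(n::nat) x y.
      (\<forall>i<n. a \<le> x i \<and> x i \<le> y i \<and> y i \<le> b) \<and>
      (\<forall>i<n. \<forall>j<n. i \<noteq> j \<longrightarrow> {x i<..<y i} \<inter> {x j<..<y j} = {}) \<and>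
      (\<Sum>i<n. y i - x i) < \<delta> \<longrightarrow> (\<Sum>i<n. \<bar>h (y i) - h (x i)\<bar>) < \<epsilon>"
  proof (intro exI[of _ "min \<delta>1 \<delta>2"] conjI allI impI)
    fix n :: nat and x y :: "nat \<Rightarrow> real"
    assume *: "(\<forall>i<n. a \<le> x i \<and> x i \<le> y i \<and> y i \<le> b) \<and>
      (\<forall>i<n. \<forall>j<n. i \<noteq> j \<longrightarrow> {x i<..<y i} \<inter> {x j<..<y j} = {}) \<and>
      (\<Sum>i<n. y i - x i) < min \<delta>1 \<delta>2"
    have "(\<Sum>i<n. \<bar>h (y i) - h (x i)\<bar>)
        \<le> (\<Sum>i<n. B * (\<bar>f (y i) - f (x i)\<bar> + \<bar>g (y i) - g (x i)\<bar>))"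
      by (intro sum_mono le) (use * in auto)
    also have "\<dots> = B * ((\<Sum>i<n. \<bar>f (y i) - f (x i)\<bar>) + (\<Sum>i<n. \<bar>g (y i) - g (x i)\<bar>))"
      by (simp add: sum_distrib_left sum.distrib algebra_simps)
    also have "\<dots> < B * (\<epsilon> / (2 * B) + \<epsilon> / (2 * B))"
      using * \<open>B > 0\<close> by (intro mult_strict_left_mono add_strict_mono \<delta>1 \<delta>2) auto
    also have "\<dots> = \<epsilon>" using \<open>B > 0\<close> by (simp add: field_simps)
    finally show "(\<Sum>i<n. \<bar>h (y i) - h (x i)\<bar>) < \<epsilon>" .
  qed (use \<open>\<delta>1 > 0\<close> \<open>\<delta>2 > 0\<close> in auto)
qed

lemma absolutely_continuous_on_Icc_ident: "absolutely_continuous_on_Icc a b (\<lambda>x. x)"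
  unfolding absolutely_continuous_on_Icc_def
  by (intro allI impI, rule_tac x=\<epsilon> in exI) (auto simp: abs_of_nonneg)

lemma absolutely_continuous_on_Icc_add_scaled:
  assumes "absolutely_continuous_on_Icc a b f" "absolutely_continuous_on_Icc a b g"
  shows "absolutely_continuous_on_Icc a b (\<lambda>x. c * f x + d * g x)"
proof (rule absolutely_continuous_on_Icc_if_sums_controlled[OF assms, of "1 + \<bar>c\<bar> + \<bar>d\<bar>"])
  fix x y
  have "\<bar>c * f y + d * g y - (c * f x + d * g x)\<bar> = \<bar>c * (f y - f x) + d * (g y - g x)\<bar>"
    by (simp add: algebra_simps)
  also have "\<dots> \<le> \<bar>c\<bar> * \<bar>f y - f x\<bar> + \<bar>d\<bar> * \<bar>g y - g x\<bar>"
    by (metis abs_mult abs_triangle_ineq)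
  also have "\<dots> \<le> (1 + \<bar>c\<bar> + \<bar>d\<bar>) * \<bar>f y - f x\<bar> + (1 + \<bar>c\<bar> + \<bar>d\<bar>) * \<bar>g y - g x\<bar>"
    by (intro add_mono mult_right_mono) auto
  finally show "\<bar>c * f y + d * g y - (c * f x + d * g x)\<bar>
      \<le> (1 + \<bar>c\<bar> + \<bar>d\<bar>) * (\<bar>f y - f x\<bar> + \<bar>g y - g x\<bar>)"
    by (simp add: algebra_simps)
qed auto

lemma absolutely_continuous_on_Icc_mult:
  assumes f: "absolutely_continuous_on_Icc a b f" and g: "absolutely_continuous_on_Icc a b g"
  shows "absolutely_continuous_on_Icc a b (\<lambda>x. f x * g x)"
proof -
  have "bounded (f ` {a..b})" "bounded (g ` {a..b})"
    using f g by (auto intro!: compact_imp_bounded compact_continuous_image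
        absolutely_continuous_on_Icc_imp_continuous_on)
  then obtain A B where "A > 0" "B > 0" and A: "\<And>x. x \<in> {a..b} \<Longrightarrow> \<bar>f x\<bar> \<le> A"
    and B: "\<And>x. x \<in> {a..b} \<Longrightarrow> \<bar>g x\<bar> \<le> B"
    unfolding bounded_pos by (metis imageI real_norm_def)
  show ?thesis
  proof (rule absolutely_continuous_on_Icc_if_sums_controlled[OF f g, of "A + B"])
    fix x y assume xy: "a \<le> x" "x \<le> y" "y \<le> b"
    have "\<bar>f y * g y - f x * g x\<bar> = \<bar>(f y - f x) * g y + f x * (g y - g x)\<bar>"
      by (simp add: algebra_simps)
    also have "\<dots> \<le> \<bar>f y - f x\<bar> * \<bar>g y\<bar> + \<bar>f x\<bar> * \<bar>g y - g x\<bar>"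
      by (metis abs_mult abs_triangle_ineq)
    also have "\<dots> \<le> \<bar>f y - f x\<bar> * (A + B) + (A + B) * \<bar>g y - g x\<bar>"
      using A[of x] B[of y] xy \<open>A > 0\<close> \<open>B > 0\<close>
      by (intro add_mono mult_right_mono mult_left_mono) auto
    finally show "\<bar>f y * g y - f x * g x\<bar> \<le> (A + B) * (\<bar>f y - f x\<bar> + \<bar>g y - g x\<bar>)"
      by (simp add: algebra_simps)
  qed (use \<open>A > 0\<close> \<open>B > 0\<close> in auto)
qed

lemma absolutely_continuous_on_Icc_if_continuous_derivative:
  assumes d: "\<And>x. x \<in> {a..b} \<Longrightarrow> (f has_real_derivative f' x) (at x within {a..b})"
    and "continuous_on {a..b} f'"
  shows "absolutely_continuous_on_Icc a b f"
proof -
  have "bounded (f' ` {a..b})"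
    using assms(2) by (intro compact_imp_bounded compact_continuous_image) auto
  then obtain B where "B > 0" and B: "\<And>x. x \<in> {a..b} \<Longrightarrow> \<bar>f' x\<bar> \<le> B"
    unfolding bounded_pos by (metis imageI real_norm_def)
  show ?thesis
  proof (rule absolutely_continuous_on_Icc_if_sums_controlled
      [OF absolutely_continuous_on_Icc_ident absolutely_continuous_on_Icc_ident \<open>B > 0\<close>])
    fix x y assume xy: "a \<le> x" "x \<le> y" "y \<le> b"
    have "norm (f y - f x) \<le> B * norm (y - x)"
      by (rule field_differentiable_bound[of "{a..b}" f f']) (use d B xy in auto)
    also have "\<dots> \<le> B * (\<bar>y - x\<bar> + \<bar>y - x\<bar>)"
      using \<open>B > 0\<close> by (intro mult_left_mono) auto
    finally show "\<bar>f y - f x\<bar> \<le> B * (\<bar>y - x\<bar> + \<bar>y - x\<bar>)" by simp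
  qed
qed

text \<open>
  The gauge at a point outside \<open>N\<close> comes from differentiability, exactly as in the classical proof.
  At a point of \<open>N\<close> it keeps the interval inside an open set \<open>U \<supseteq> N\<close> of measure below the \<open>\<delta>\<close> of
  absolute continuity, so that all intervals tagged in \<open>N\<close> together contribute little to the increment
  of \<open>f\<close>.  They contribute nothing to the Riemann sum after \<open>g\<close> has been set to \<open>0\<close> on \<open>N\<close>, which does
  not change the integral.
\<close>

lemma fundamental_theorem_of_calculus_absolutely_continuous:
  fixes f g :: "real \<Rightarrow> real"
  assumes "a \<le> b" and ac: "absolutely_continuous_on_Icc a b f" and N: "negligible N"
    and vecd: "\<And>x. x \<in> {a..b} - N \<Longrightarrow> (f has_real_derivative g x) (at x within {a..b})"
  shows "(g has_integral (f b - f a)) {a..b}"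
proof -
  define h where "h x = (if x \<in> N then 0 else g x)" for x
  have "(h has_integral (f b - f a)) {a..b}"
    unfolding has_integral_real
  proof (intro allI impI)
    fix e :: real assume "e > 0"
    \<comment> \<open>The summand \<open>1\<close> takes care of \<open>a = b\<close>.\<close>
    define e' where "e' = e / (2 * (b - a + 1))"
    have "e' > 0" using \<open>e > 0\<close> \<open>a \<le> b\<close> by (simp add: e'_def)
    have "e / 2 > 0" using \<open>e > 0\<close> by simp
    obtain \<delta> where "\<delta> > 0" and \<delta>: "\<forall>(S :: (real \<times> real set) set) x y.
      finite S \<and> (\<forall>i\<in>S. a \<le> x i \<and> x i \<le> y i \<and> y i \<le> b) \<and>
      (\<forall>i\<in>S. \<forall>j\<in>S. i \<noteq> j \<longrightarrow> {x i<..<y i} \<inter> {x j<..<y j} = {}) \<and>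
      (\<Sum>i\<in>S. y i - x i) < \<delta> \<longrightarrow> (\<Sum>i\<in>S. \<bar>f (y i) - f (x i)\<bar>) < e/2"
      by (rule absolutely_continuous_on_Icc_finite[OF ac \<open>e / 2 > 0\<close>, where 'i = "real \<times> real set"])
    obtain U where "open U" "N \<subseteq> U" and U: "U \<in> lmeasurable" "measure lebesgue U < \<delta>"
    proof -
      have N': "N \<in> null_sets lebesgue" using N by (simp add: negligible_iff_null_sets)
      then obtain T where T: "open T" "N \<subseteq> T" "T - N \<in> lmeasurable"
          "emeasure lebesgue (T - N) < ennreal \<delta>"
        using sets_lebesgue_outer_open[OF _ \<open>\<delta> > 0\<close>, of N] by blast
      have "T \<in> sets lebesgue" using T(1) by auto
      then have "emeasure lebesgue T = emeasure lebesgue (T - N)"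
        using N' by (simp add: emeasure_Diff_null_set)
      with T(4) have *: "emeasure lebesgue T < ennreal \<delta>" by simp
      then have "T \<in> lmeasurable"
        using \<open>T \<in> sets lebesgue\<close> by (intro fmeasurableI) (auto intro: less_trans)
      moreover from this * have "measure lebesgue T < \<delta>"
        by (simp add: emeasure_eq_measure2 ennreal_less_iff)
      ultimately show thesis using that T by blast
    qed
    have "\<exists>d>0. (x \<in> {a..b} - N \<longrightarrow>
         (\<forall>y\<in>{a..b}. norm (y-x) < d \<longrightarrow> norm (f y - f x - (y-x) * h x) \<le> e' * norm (y-x)))
         \<and> (x \<in> N \<longrightarrow> ball x d \<subseteq> U)" for x
    proof (cases "x \<in> N")
      case True
      then have "x \<in> U" using \<open>N \<subseteq> U\<close> by blast
      then show ?thesis using \<open>open U\<close> True by (metis DiffD2 openE)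
    next
      case False
      show ?thesis
      proof (cases "x \<in> {a..b}")
        case True
        with False have "(f has_derivative (\<lambda>y. h x * y)) (at x within {a..b})"
          using vecd[of x] by (simp add: has_field_derivative_def h_def)
        then show ?thesis
          using False \<open>e' > 0\<close> unfolding has_derivative_within_alt
          by (auto simp: mult.commute)
      qed (use False in \<open>auto intro!: exI[of _ 1]\<close>)
    qed
    then obtain d where d0: "\<And>x. 0 < d x"
      and d: "\<And>x y. \<lbrakk>x \<in> {a..b} - N; y \<in> {a..b}; norm (y-x) < d x\<rbrakk>
                        \<Longrightarrow> norm (f y - f x - (y-x) * h x) \<le> e' * norm (y-x)"
      and dU: "\<And>x. x \<in> N \<Longrightarrow> ball x (d x) \<subseteq> U"
      by metis
    show "\<exists>\<gamma>. gauge \<gamma> \<and> (\<forall>p. p tagged_division_of {a..b} \<and> \<gamma> fine p \<longrightarrow>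
        norm ((\<Sum>(x,K)\<in>p. Henstock_Kurzweil_Integration.content K *\<^sub>R h x) - (f b - f a)) < e)"
    proof (intro exI[of _ "\<lambda>x. ball x (d x)"] conjI allI impI)
      show "gauge (\<lambda>x. ball x (d x))" using d0 gauge_ball_dependent by blast
    next
      fix p assume "p tagged_division_of {a..b} \<and> (\<lambda>x. ball x (d x)) fine p"
      then have p: "p tagged_division_of {a..b}" and fine: "(\<lambda>x. ball x (d x)) fine p" by auto
      define l r where "l i = Inf (snd i)" and "r i = Sup (snd i)" for i :: "real \<times> real set"
      have K: "snd i = {l i..r i} \<and> a \<le> l i \<and> l i \<le> fst i \<and> fst i \<le> r i \<and> r i \<le> b" if "i \<in> p" for i
      proof -
        obtain x K where i: "i = (x, K)" by force
        with p that have "x \<in> K" "K \<subseteq> {a..b}" "\<exists>u v. K = cbox u v"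
          by (blast dest: tagged_division_ofD)+
        then show ?thesis unfolding i l_def r_def by auto
      qed
      have disj: "{l i<..<r i} \<inter> {l j<..<r j} = {}" if "i \<in> p" "j \<in> p" "i \<noteq> j" for i j
      proof -
        have "interior (snd i) \<inter> interior (snd j) = {}"
          using tagged_division_ofD(5)[OF p, of "fst i" "snd i" "fst j" "snd j"] that by simp
        with K[OF that(1)] K[OF that(2)] show ?thesis by simp
      qed
      have fin: "finite p" using p by blast
      let ?A = "{i \<in> p. fst i \<in> N}" and ?B = "{i \<in> p. fst i \<notin> N}"
      let ?D = "\<lambda>i. Henstock_Kurzweil_Integration.content (snd i) * h (fst i) - (f (r i) - f (l i))"
      have sumid: "b - a = (\<Sum>i\<in>p. r i - l i)" and sumf: "f b - f a = (\<Sum>i\<in>p. f (r i) - f (l i))"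
        using additive_tagged_division_1[OF \<open>a \<le> b\<close> p, of "\<lambda>x. x"]
          additive_tagged_division_1[OF \<open>a \<le> b\<close> p, of f]
        by (simp_all add: l_def r_def split_beta)
      \<comment> \<open>Intervals tagged outside \<open>N\<close>: the straddle estimate, in total at most \<open>e' * (b - a)\<close>.\<close>
      have good: "(\<Sum>i\<in>?B. \<bar>?D i\<bar>) \<le> e/2"
      proof -
        have "(\<Sum>i\<in>?B. \<bar>?D i\<bar>) \<le> (\<Sum>i\<in>?B. e' * (r i - l i))"
        proof (rule sum_mono)
          fix i assume i: "i \<in> ?B"
          then have Ki: "snd i = {l i..r i}" "a \<le> l i" "l i \<le> fst i" "fst i \<le> r i" "r i \<le> b"
            using K by auto
          have "snd i \<subseteq> ball (fst i) (d (fst i))"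
            using fine i by (auto simp: fine_def split_beta)
          moreover have "l i \<in> snd i" "r i \<in> snd i"
            using Ki by auto
          ultimately have "l i \<in> ball (fst i) (d (fst i))" "r i \<in> ball (fst i) (d (fst i))"
            by blast+
          then have "norm (l i - fst i) < d (fst i)" "norm (r i - fst i) < d (fst i)"
            by (auto simp: dist_real_def)
          then have "norm (f (l i) - f (fst i) - (l i - fst i) * h (fst i)) \<le> e' * norm (l i - fst i)"
            "norm (f (r i) - f (fst i) - (r i - fst i) * h (fst i)) \<le> e' * norm (r i - fst i)"
            using d[of "fst i" "l i"] d[of "fst i" "r i"] i Ki by auto
          moreover have "?D i = (f (l i) - f (fst i) - (l i - fst i) * h (fst i))
              - (f (r i) - f (fst i) - (r i - fst i) * h (fst i))"
            using Ki by (simp add: algebra_simps)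
          moreover have "e' * norm (l i - fst i) + e' * norm (r i - fst i) = e' * (r i - l i)"
            using Ki by (simp add: algebra_simps abs_if)
          ultimately show "\<bar>?D i\<bar> \<le> e' * (r i - l i)" by (simp only: real_norm_def)
        qed
        also have "\<dots> \<le> (\<Sum>i\<in>p. e' * (r i - l i))"
          by (rule sum_mono2[OF fin]) (use K \<open>e' > 0\<close> in \<open>fastforce+\<close>)
        also have "\<dots> = e' * (b - a)" by (simp add: sumid sum_distrib_left)
        also have "\<dots> \<le> e' * (b - a + 1)" using \<open>e' > 0\<close> by (intro mult_left_mono) auto
        also have "\<dots> = e/2" using \<open>a \<le> b\<close> by (simp add: e'_def divide_simps)
        finally show ?thesis .
      qed
      \<comment> \<open>Intervals tagged in \<open>N\<close>: their interiors are disjoint and lie in \<open>U\<close>, so absolute continuity applies.\<close>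
      have bad: "(\<Sum>i\<in>?A. \<bar>?D i\<bar>) < e/2"
      proof -
        have "(\<Sum>i\<in>?A. r i - l i) = (\<Sum>i\<in>?A. measure lebesgue {l i<..<r i})"
          by (rule sum.cong) (use K in \<open>fastforce+\<close>)
        also have "\<dots> = measure lebesgue (\<Union>i\<in>?A. {l i<..<r i})"
          using fin disj by (intro measure_UNION'[symmetric])
            (auto simp: pairwise_def disjnt_def)
        also have "\<dots> \<le> measure lebesgue U"
        proof (rule measure_mono_fmeasurable[OF _ _ U(1)])
          show "(\<Union>i\<in>?A. {l i<..<r i}) \<subseteq> U"
          proof
            fix y assume "y \<in> (\<Union>i\<in>?A. {l i<..<r i})"
            then obtain i where i: "i \<in> p" "fst i \<in> N" and y: "y \<in> {l i<..<r i}" by blast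
            have "snd i \<subseteq> ball (fst i) (d (fst i))"
              using fine \<open>i \<in> p\<close> by (auto simp: fine_def split_beta)
            moreover have "y \<in> snd i" using K[OF \<open>i \<in> p\<close>] y by auto
            ultimately show "y \<in> U" using dU[OF i(2)] by blast
          qed
        qed (use fin in \<open>auto intro!: sets.finite_UN\<close>)
        also have "\<dots> < \<delta>" by fact
        finally have "(\<Sum>i\<in>?A. \<bar>f (r i) - f (l i)\<bar>) < e/2"
        proof (intro \<delta>[rule_format] conjI ballI impI)
          fix i j assume "i \<in> ?A" "j \<in> ?A" "i \<noteq> j"
          then show "{l i<..<r i} \<inter> {l j<..<r j} = {}" using disj[of i j] by simp
        next
          fix i assume "i \<in> ?A"
          then show "a \<le> l i" "l i \<le> r i" "r i \<le> b" using K[of i] by simp_all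
        qed (use fin in simp_all)
        moreover have "(\<Sum>i\<in>?A. \<bar>?D i\<bar>) = (\<Sum>i\<in>?A. \<bar>f (r i) - f (l i)\<bar>)"
          by (rule sum.cong) (auto simp: h_def)
        ultimately show ?thesis by simp
      qed
      have "(\<Sum>(x,K)\<in>p. Henstock_Kurzweil_Integration.content K *\<^sub>R h x) - (f b - f a) = (\<Sum>i\<in>p. ?D i)"
        by (simp add: sumf sum_subtractf split_beta)
      also have "\<bar>\<dots>\<bar> \<le> (\<Sum>i\<in>p. \<bar>?D i\<bar>)" by (rule sum_abs)
      also have "\<dots> = (\<Sum>i\<in>?A. \<bar>?D i\<bar>) + (\<Sum>i\<in>?B. \<bar>?D i\<bar>)"
        using fin by (subst sum.union_disjoint[symmetric]) (auto intro!: sum.cong)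
      also have "\<dots> < e" using good bad by linarith
      finally show "norm ((\<Sum>(x,K)\<in>p. Henstock_Kurzweil_Integration.content K *\<^sub>R h x) - (f b - f a)) < e" by simp
    qed
  qed
  then show ?thesis
    by (rule has_integral_spike[OF N, rotated]) (simp add: h_def)
qed

section \<open>The space \<open>W\<^sup>2\<^sup>,\<^sup>1\<close> and the equation \<open>u'' + (a + \<lambda>) u = \<sigma>\<close>\<close>

lemma L_eq_ae_negligibleE:
  assumes "L_eq_ae a lam u \<sigma>"
  obtains N where "negligible N" and "\<And>t. t \<in> {0..1} - N \<Longrightarrow>
    (deriv_I u has_real_derivative \<sigma> t - (a t + lam) * u t) (at t within {0..1})"
proof -
  let ?P = "\<lambda>t. \<exists>u2. (deriv_I u has_real_derivative u2) (at t within {0..1}) \<and>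
      u2 + (a t + lam) * u t = \<sigma> t"
  have "AE t in lebesgue. t \<in> {0..1} \<longrightarrow> ?P t"
    using assms unfolding L_eq_ae_def by (subst (asm) AE_restrict_space_iff) auto
  then have "{t. \<not> (t \<in> {0..1} \<longrightarrow> ?P t)} \<in> null_sets lebesgue" (is "?N \<in> _")
    by (simp add: completion.AE_iff_null_sets)
  then have N: "negligible ?N" by (simp only: negligible_iff_null_sets)
  show thesis
  proof (rule that[OF N])
    fix t assume t: "t \<in> {0..1} - ?N"
    then obtain u2 where u2: "(deriv_I u has_real_derivative u2) (at t within {0..1})"
      and eq: "u2 + (a t + lam) * u t = \<sigma> t" by blast
    from eq have "u2 = \<sigma> t - (a t + lam) * u t" by simp
    with u2 show "(deriv_I u has_real_derivative \<sigma> t - (a t + lam) * u t) (at t within {0..1})"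
      by simp
  qed
qed

lemma L_eq_ae_negligibleI:
  assumes N: "negligible N" and "\<And>t. t \<in> {0..1} - N \<Longrightarrow>
    (deriv_I u has_real_derivative \<sigma> t - (a t + lam) * u t) (at t within {0..1})"
  shows "L_eq_ae a lam u \<sigma>"
proof -
  have "N \<in> null_sets lebesgue" using N by (simp add: negligible_iff_null_sets)
  then have "AE t in lebesgue. t \<in> {0..1} \<longrightarrow>
      (\<exists>u2. (deriv_I u has_real_derivative u2) (at t within {0..1}) \<and> u2 + (a t + lam) * u t = \<sigma> t)"
  proof (rule AE_I')
    have "\<exists>u2. (deriv_I u has_real_derivative u2) (at t within {0..1}) \<and> u2 + (a t + lam) * u t = \<sigma> t"
      if "t \<in> {0..1} - N" for t
      by (rule exI[of _ "\<sigma> t - (a t + lam) * u t"]) (use assms(2)[OF that] in simp)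
    then show "{t \<in> space lebesgue. \<not> (t \<in> {0..1} \<longrightarrow> (\<exists>u2. (deriv_I u has_real_derivative u2)
        (at t within {0..1}) \<and> u2 + (a t + lam) * u t = \<sigma> t))} \<subseteq> N" by blast
  qed
  then show ?thesis unfolding L_eq_ae_def by (subst AE_restrict_space_iff) auto
qed

lemma has_real_derivative_deriv_I:
  assumes "u \<in> W21" and "t \<in> {0..1}"
  shows "(u has_real_derivative deriv_I u t) (at t within {0..1})"
  using assms unfolding W21_def deriv_I_def differentiable_on_def
  by (simp add: has_real_derivative_iff_has_vector_derivative vector_derivative_works)

lemma deriv_I_eqI:
  assumes "(u has_real_derivative d) (at t within {0..1})" and "t \<in> {0..1}"
  shows "deriv_I u t = d"
  using vector_derivative_within_cbox[of 0 1 t u d] assms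
  by (simp add: deriv_I_def has_real_derivative_iff_has_vector_derivative)

lemma W21_continuous_on: "u \<in> W21 \<Longrightarrow> continuous_on {0..1} u"
  by (simp add: W21_def)

lemma W21_ac_deriv_I: "u \<in> W21 \<Longrightarrow> absolutely_continuous_on_Icc 0 1 (deriv_I u)"
  by (simp add: W21_def)

lemma W21_ac: "u \<in> W21 \<Longrightarrow> absolutely_continuous_on_Icc 0 1 u"
  by (blast intro: absolutely_continuous_on_Icc_if_continuous_derivative
      has_real_derivative_deriv_I absolutely_continuous_on_Icc_imp_continuous_on W21_ac_deriv_I)

lemma deriv_I_linear_combination:
  assumes "u \<in> W21" "w \<in> W21" "t \<in> {0..1}"
  shows "deriv_I (\<lambda>t. c * u t + d * w t) t = c * deriv_I u t + d * deriv_I w t"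
  by (rule deriv_I_eqI) (use assms in \<open>auto intro!: derivative_eq_intros has_real_derivative_deriv_I\<close>)

lemma W21_linear_combination:
  assumes u: "u \<in> W21" and w: "w \<in> W21"
  shows "(\<lambda>t. c * u t + d * w t) \<in> W21"
proof -
  have "absolutely_continuous_on_Icc 0 1 (\<lambda>t. c * deriv_I u t + d * deriv_I w t)"
    by (intro absolutely_continuous_on_Icc_add_scaled W21_ac_deriv_I u w)
  then have "absolutely_continuous_on_Icc 0 1 (deriv_I (\<lambda>t. c * u t + d * w t))"
    by (rule absolutely_continuous_on_Icc_if_sums_controlled[OF _ absolutely_continuous_on_Icc_ident zero_less_one])
      (simp add: deriv_I_linear_combination[OF u w])
  moreover have "continuous_on {0..1} (\<lambda>t. c * u t + d * w t)"
    by (intro continuous_intros W21_continuous_on u w)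
  moreover have "(\<lambda>t. c * u t + d * w t) differentiable_on {0..1}"
    using u w by (auto simp: W21_def intro!: derivative_intros)
  ultimately show ?thesis by (simp add: W21_def)
qed

lemma L_eq_ae_linear_combination:
  assumes u: "u \<in> W21" and w: "w \<in> W21"
    and Lu: "L_eq_ae a lam u (\<lambda>_. 0)" and Lw: "L_eq_ae a lam w (\<lambda>_. 0)"
  shows "L_eq_ae a lam (\<lambda>t. c * u t + d * w t) (\<lambda>_. 0)"
proof -
  obtain N1 where N1: "negligible N1" "\<And>t. t \<in> {0..1} - N1 \<Longrightarrow>
    (deriv_I u has_real_derivative 0 - (a t + lam) * u t) (at t within {0..1})"
    using L_eq_ae_negligibleE[OF Lu] by blast
  obtain N2 where N2: "negligible N2" "\<And>t. t \<in> {0..1} - N2 \<Longrightarrow>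
    (deriv_I w has_real_derivative 0 - (a t + lam) * w t) (at t within {0..1})"
    using L_eq_ae_negligibleE[OF Lw] by blast
  show ?thesis
  proof (rule L_eq_ae_negligibleI)
    show "negligible (N1 \<union> N2)" using N1(1) N2(1) by (rule negligible_Un)
    fix t assume t: "t \<in> {0..1} - (N1 \<union> N2)"
    have "((\<lambda>t. c * deriv_I u t + d * deriv_I w t) has_real_derivative
        c * (0 - (a t + lam) * u t) + d * (0 - (a t + lam) * w t)) (at t within {0..1})"
      by (intro DERIV_add DERIV_cmult N1(2) N2(2)) (use t in auto)
    then have "(deriv_I (\<lambda>t. c * u t + d * w t) has_real_derivative
        c * (0 - (a t + lam) * u t) + d * (0 - (a t + lam) * w t)) (at t within {0..1})"
      by (rule has_field_derivative_transform_within[OF _ zero_less_one])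
        (use t in \<open>auto simp: deriv_I_linear_combination[OF u w]\<close>)
    then show "(deriv_I (\<lambda>t. c * u t + d * w t) has_real_derivative
        0 - (a t + lam) * (c * u t + d * w t)) (at t within {0..1})"
      by (simp add: algebra_simps)
  qed
qed

section \<open>The Lagrange identity and uniqueness for the Cauchy problem\<close>

text \<open>
  The function \<open>u' w - u w'\<close> is absolutely continuous, and its derivative is
  \<open>u'' w - u w'' = \<sigma> w\<close> almost everywhere because the terms with \<open>a + lam\<close> cancel.
\<close>

lemma Lagrange_identity:
  assumes u: "u \<in> W21" and w: "w \<in> W21"
    and Lu: "L_eq_ae a lam u \<sigma>" and Lw: "L_eq_ae a lam w (\<lambda>_. 0)"
    and xy: "0 \<le> x" "x \<le> y" "y \<le> 1"
  shows "((\<lambda>s. \<sigma> s * w s) has_integral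
      (deriv_I u y * w y - u y * deriv_I w y) - (deriv_I u x * w x - u x * deriv_I w x)) {x..y}"
proof -
  obtain N1 where N1: "negligible N1" "\<And>t. t \<in> {0..1} - N1 \<Longrightarrow>
    (deriv_I u has_real_derivative \<sigma> t - (a t + lam) * u t) (at t within {0..1})"
    using L_eq_ae_negligibleE[OF Lu] by blast
  obtain N2 where N2: "negligible N2" "\<And>t. t \<in> {0..1} - N2 \<Longrightarrow>
    (deriv_I w has_real_derivative 0 - (a t + lam) * w t) (at t within {0..1})"
    using L_eq_ae_negligibleE[OF Lw] by blast
  have ac: "absolutely_continuous_on_Icc x y
      (\<lambda>t. 1 * (deriv_I u t * w t) + (- 1) * (u t * deriv_I w t))"
    by (rule absolutely_continuous_on_Icc_subset[OF _ xy(1,3)])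
      (intro absolutely_continuous_on_Icc_add_scaled absolutely_continuous_on_Icc_mult
        W21_ac_deriv_I W21_ac u w)
  have "((\<lambda>s. \<sigma> s * w s) has_integral
      (1 * (deriv_I u y * w y) + (- 1) * (u y * deriv_I w y)) -
      (1 * (deriv_I u x * w x) + (- 1) * (u x * deriv_I w x))) {x..y}"
  proof (rule fundamental_theorem_of_calculus_absolutely_continuous[OF xy(2) ac])
    show "negligible (N1 \<union> N2)" using N1(1) N2(1) by (rule negligible_Un)
    fix t assume t: "t \<in> {x..y} - (N1 \<union> N2)"
    then have t01: "t \<in> {0..1}" using xy by auto
    have "((\<lambda>t. deriv_I u t * w t - u t * deriv_I w t) has_real_derivative
        ((\<sigma> t - (a t + lam) * u t) * w t + deriv_I w t * deriv_I u t) -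
        (deriv_I u t * deriv_I w t + (0 - (a t + lam) * w t) * u t)) (at t within {0..1})"
      by (intro DERIV_diff DERIV_mult N1(2) N2(2) has_real_derivative_deriv_I u w)
        (use t t01 in auto)
    then have "((\<lambda>t. deriv_I u t * w t - u t * deriv_I w t) has_real_derivative \<sigma> t * w t)
        (at t within {0..1})"
      by (simp add: algebra_simps)
    then show "((\<lambda>t. 1 * (deriv_I u t * w t) + (- 1) * (u t * deriv_I w t))
        has_real_derivative \<sigma> t * w t) (at t within {x..y})"
      using xy by (auto intro: has_field_derivative_subset)
  qed
  then show ?thesis by simp
qed

lemma deriv_I_diff_has_integral:
  assumes u: "u \<in> W21" and Lu: "L_eq_ae a lam u \<sigma>" and xy: "0 \<le> x" "x \<le> y" "y \<le> 1"
  shows "((\<lambda>s. \<sigma> s - (a s + lam) * u s) has_integral deriv_I u y - deriv_I u x) {x..y}"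
proof -
  obtain N where N: "negligible N" "\<And>t. t \<in> {0..1} - N \<Longrightarrow>
    (deriv_I u has_real_derivative \<sigma> t - (a t + lam) * u t) (at t within {0..1})"
    using L_eq_ae_negligibleE[OF Lu] by blast
  show ?thesis
    by (rule fundamental_theorem_of_calculus_absolutely_continuous[OF xy(2) _ N(1)],
        rule absolutely_continuous_on_Icc_subset[OF W21_ac_deriv_I[OF u] xy(1,3)],
        rule has_field_derivative_subset[OF N(2)]) (use xy in auto)
qed

text \<open>
  On an interval to the right of \<open>t0\<close> that is so short that \<open>\<kappa> = \<integral> \<bar>a + lam\<bar>\<close> is less than \<open>1\<close>, the maximum \<open>M\<close> of
  \<open>\<bar>u\<bar>\<close> satisfies \<open>\<bar>u'\<bar> \<le> M \<kappa>\<close> by integrating the equation, and then \<open>M \<le> M \<kappa>\<close> by the mean value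
  theorem, since the interval has length at most \<open>1\<close>.  Hence \<open>M = 0\<close>.
\<close>

lemma zero_Cauchy_data_imp_locally_zero:
  assumes a: "integrable (lebesgue_on {0..1}) a"
    and u: "u \<in> W21" and Lu: "L_eq_ae a lam u (\<lambda>_. 0)"
    and t0: "0 \<le> t0" "t0 < 1" and u0: "u t0 = 0" "deriv_I u t0 = 0"
  obtains T where "t0 < T" "T \<le> 1" "\<And>x. x \<in> {t0..T} \<Longrightarrow> u x = 0 \<and> deriv_I u x = 0"
proof -
  define q where "q t = a t + lam" for t
  have "integrable (lebesgue_on {0..1}) (\<lambda>t. \<bar>q t\<bar>)"
    unfolding q_def by (intro integrable_abs Bochner_Integration.integrable_add a
        continuous_imp_integrable_real continuous_intros)
  then have q: "(\<lambda>t. \<bar>q t\<bar>) integrable_on {0..1}"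
    using has_integral_integral_lebesgue_on by fastforce
  have qsub: "(\<lambda>t. \<bar>q t\<bar>) integrable_on {x..y}" if "0 \<le> x" "y \<le> 1" for x y
    by (rule integrable_on_subinterval[OF q]) (use that in auto)
  obtain T where T: "t0 < T" "T \<le> 1" and small: "integral {t0..T} (\<lambda>t. \<bar>q t\<bar>) < 1"
  proof -
    have "continuous_on {t0..1} (\<lambda>x. integral {t0..x} (\<lambda>t. \<bar>q t\<bar>))"
      by (rule indefinite_integral_continuous_1, rule qsub) (use t0 in auto)
    then obtain d where "d > 0" and d: "\<And>x. \<lbrakk>x \<in> {t0..1}; dist x t0 < d\<rbrakk> \<Longrightarrow>
        dist (integral {t0..x} (\<lambda>t. \<bar>q t\<bar>)) (integral {t0..t0} (\<lambda>t. \<bar>q t\<bar>)) < 1"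
      unfolding continuous_on_iff using t0 by (metis atLeastAtMost_iff less_eq_real_def zero_less_one)
    show thesis
    proof
      show "t0 < min 1 (t0 + d/2)" "min 1 (t0 + d/2) \<le> 1" using \<open>d > 0\<close> t0 by auto
      show "integral {t0..min 1 (t0 + d/2)} (\<lambda>t. \<bar>q t\<bar>) < 1"
        using d[of "min 1 (t0 + d/2)"] \<open>d > 0\<close> t0 by (auto simp: dist_real_def min_def split: if_splits)
    qed
  qed
  obtain m where m: "m \<in> {t0..T}" and max: "\<And>x. x \<in> {t0..T} \<Longrightarrow> \<bar>u x\<bar> \<le> \<bar>u m\<bar>"
  proof -
    have "continuous_on {t0..T} (\<lambda>x. \<bar>u x\<bar>)"
      using t0 T by (intro continuous_intros continuous_on_subset[OF W21_continuous_on[OF u]]) auto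
    then show thesis
      using continuous_attains_sup[of "{t0..T}" "\<lambda>x. \<bar>u x\<bar>"] T that by auto
  qed
  define \<kappa> where "\<kappa> = integral {t0..T} (\<lambda>t. \<bar>q t\<bar>)"
  have deriv_le: "\<bar>deriv_I u x\<bar> \<le> \<bar>u m\<bar> * \<kappa>" if x: "x \<in> {t0..T}" for x
  proof -
    have I: "((\<lambda>s. 0 - (a s + lam) * u s) has_integral deriv_I u x - deriv_I u t0) {t0..x}"
      by (rule deriv_I_diff_has_integral[OF u Lu]) (use x t0 T in auto)
    have "deriv_I u x = integral {t0..x} (\<lambda>s. 0 - (a s + lam) * u s)"
      using integral_unique[OF I] unfolding u0 by (simp only: diff_0_right)
    also have "norm \<dots> \<le> integral {t0..x} (\<lambda>s. \<bar>u m\<bar> * \<bar>q s\<bar>)"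
    proof (rule Henstock_Kurzweil_Integration.integral_norm_bound_integral)
      show "(\<lambda>s. \<bar>u m\<bar> * \<bar>q s\<bar>) integrable_on {t0..x}"
        by (intro integrable_on_mult_right qsub) (use x t0 T in auto)
      fix s assume "s \<in> {t0..x}"
      then have "\<bar>u s\<bar> \<le> \<bar>u m\<bar>" using max x by auto
      then have "\<bar>u s\<bar> * \<bar>q s\<bar> \<le> \<bar>u m\<bar> * \<bar>q s\<bar>" by (rule mult_right_mono) simp
      then show "norm (0 - (a s + lam) * u s) \<le> \<bar>u m\<bar> * \<bar>q s\<bar>"
        by (simp add: q_def abs_mult mult.commute)
    qed (use I in blast)
    also have "\<dots> = \<bar>u m\<bar> * integral {t0..x} (\<lambda>s. \<bar>q s\<bar>)" by simp
    also have "\<dots> \<le> \<bar>u m\<bar> * \<kappa>"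
      unfolding \<kappa>_def by (intro mult_left_mono integral_subset_le qsub) (use x t0 T in auto)
    finally show ?thesis by simp
  qed
  have "\<bar>u m\<bar> = norm (u m - u t0)" using u0 by simp
  also have "\<dots> \<le> (\<bar>u m\<bar> * \<kappa>) * norm (m - t0)"
  proof (rule field_differentiable_bound[of "{t0..T}" u "deriv_I u"])
    fix x assume "x \<in> {t0..T}"
    then show "(u has_field_derivative deriv_I u x) (at x within {t0..T})"
      using t0 T by (intro has_field_derivative_subset[OF has_real_derivative_deriv_I[OF u]]) auto
  qed (use deriv_le m T in auto)
  also have "\<dots> \<le> (\<bar>u m\<bar> * \<kappa>) * 1"
    using m t0 T deriv_le[of t0] by (intro mult_left_mono) auto
  finally have "\<bar>u m\<bar> * (1 - \<kappa>) \<le> 0" by (simp add: algebra_simps)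
  then have "u m = 0" using small by (simp add: \<kappa>_def mult_le_0_iff)
  with max deriv_le T show thesis by (intro that[of T]) force+
qed

text \<open>
  The largest interval \<open>[0, t0]\<close> on which \<open>u\<close> and \<open>u'\<close> vanish exists because both are continuous, and the
  local result would extend it if \<open>t0 < 1\<close>.
\<close>

lemma zero_Cauchy_data_imp_zero:
  assumes a: "integrable (lebesgue_on {0..1}) a"
    and u: "u \<in> W21" and Lu: "L_eq_ae a lam u (\<lambda>_. 0)"
    and u0: "u 0 = 0" "deriv_I u 0 = 0" and t: "t \<in> {0..1}"
  shows "u t = 0 \<and> deriv_I u t = 0"
proof -
  define Z where "Z = {z \<in> {0..1}. \<forall>x\<in>{0..z}. u x = 0 \<and> deriv_I u x = 0}"
  define t0 where "t0 = Sup Z"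
  have "0 \<in> Z" using u0 by (simp add: Z_def)
  have bdd: "bdd_above Z" by (auto simp: Z_def bdd_above_def)
  have "0 \<le> t0" unfolding t0_def by (rule cSup_upper[OF \<open>0 \<in> Z\<close> bdd])
  moreover have "t0 \<le> 1"
    unfolding t0_def
  proof (rule cSup_least)
    show "Z \<noteq> {}" using \<open>0 \<in> Z\<close> by blast
  qed (simp add: Z_def)
  ultimately have t01: "0 \<le> t0" "t0 \<le> 1" .
  have zero_below: "u x = 0 \<and> deriv_I u x = 0" if "0 \<le> x" "x < t0" for x
  proof -
    obtain z where "z \<in> Z" "x < z"
      using less_cSupD[of Z x] \<open>0 \<in> Z\<close> \<open>x < t0\<close> by (auto simp: t0_def)
    then show ?thesis using \<open>0 \<le> x\<close> by (simp add: Z_def)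
  qed
  have "closed {x \<in> {0..1}. u x = 0}"
    by (rule continuous_closed_preimage_constant[OF W21_continuous_on[OF u]]) simp
  moreover have "closed {x \<in> {0..1}. deriv_I u x = 0}"
    by (rule continuous_closed_preimage_constant[OF
          absolutely_continuous_on_Icc_imp_continuous_on[OF W21_ac_deriv_I[OF u]]]) simp
  ultimately have "closed ({x \<in> {0..1}. u x = 0} \<inter> {x \<in> {0..1}. deriv_I u x = 0})"
    by (rule closed_Int)
  moreover have "Z \<subseteq> {x \<in> {0..1}. u x = 0} \<inter> {x \<in> {0..1}. deriv_I u x = 0}"
    by (auto simp: Z_def)
  moreover have "t0 \<in> closure Z"
    unfolding t0_def using \<open>0 \<in> Z\<close> bdd by (intro closure_contains_Sup) auto
  ultimately have "t0 \<in> {x \<in> {0..1}. u x = 0} \<inter> {x \<in> {0..1}. deriv_I u x = 0}"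
    using closure_minimal by blast
  then have zero: "u x = 0 \<and> deriv_I u x = 0" if "0 \<le> x" "x \<le> t0" for x
    using zero_below[of x] that by (cases "x = t0") auto
  have "t0 = 1"
  proof (rule ccontr)
    assume "t0 \<noteq> 1"
    then have "t0 < 1" using t01 by simp
    then obtain T where T: "t0 < T" "T \<le> 1" "\<And>x. x \<in> {t0..T} \<Longrightarrow> u x = 0 \<and> deriv_I u x = 0"
      using zero_Cauchy_data_imp_locally_zero[OF a u Lu t01(1)] zero[of t0] t01 by auto
    have "u x = 0 \<and> deriv_I u x = 0" if "x \<in> {0..T}" for x
      using zero[of x] T(3)[of x] that by (cases "x \<le> t0") auto
    then have "T \<in> Z" using T t01 by (simp add: Z_def)
    then have "T \<le> t0" unfolding t0_def using bdd by (rule cSup_upper)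
    with T show False by simp
  qed
  with zero t show ?thesis by simp
qed


section \<open>The Neumann problem in terms of \<open>r5\<close> and \<open>r6\<close>\<close>

text \<open>
  The Lagrange identity with \<open>\<sigma> = 0\<close> says that the Wronskian is constant; its value is read off at \<open>0\<close>,
  where \<open>r5' = 1\<close> and \<open>r6' = 0\<close>.
\<close>

lemma Wronskian_r6_r5:
  assumes r5: "is_r5 a lam r5" and r6: "is_r6 a lam r6" and t: "t \<in> {0..1}"
  shows "deriv_I r5 t * r6 t - r5 t * deriv_I r6 t = r6 0"
proof -
  have "((\<lambda>s. 0 * r6 s) has_integral
      (deriv_I r5 t * r6 t - r5 t * deriv_I r6 t) - (deriv_I r5 0 * r6 0 - r5 0 * deriv_I r6 0)) {0..t}"
    by (rule Lagrange_identity) (use r5 r6 t in \<open>auto simp: is_r5_def is_r6_def\<close>)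
  then have "(deriv_I r5 t * r6 t - r5 t * deriv_I r6 t)
      - (deriv_I r5 0 * r6 0 - r5 0 * deriv_I r6 0) = 0"
    by (rule has_integral_unique) simp
  then show ?thesis using r5 r6 by (simp add: is_r5_def is_r6_def)
qed

lemma r5_1_eq:
  assumes "is_r5 a lam r5" and "is_r6 a lam r6"
  shows "r5 1 = - r6 0"
  using Wronskian_r6_r5[OF assms, of 1] assms by (simp add: is_r5_def is_r6_def)

text \<open>
  This makes \<open>r5, r6\<close> linearly independent: if \<open>r6 0\<close> were zero, then \<open>r6\<close> would have zero Cauchy data
  at \<open>0\<close> and vanish, against \<open>r6' (1) = 1\<close>.
\<close>

lemma r6_0_nonzero:
  assumes a: "integrable (lebesgue_on {0..1}) a" and r6: "is_r6 a lam r6"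
  shows "r6 0 \<noteq> 0"
proof
  assume "r6 0 = 0"
  then have "deriv_I r6 1 = 0"
    using zero_Cauchy_data_imp_zero[OF a, of r6 lam 1] r6 by (simp add: is_r6_def)
  then show False using r6 by (simp add: is_r6_def)
qed

text \<open>
  The classical Green's function of the Neumann problem: \<open>r6\<close> satisfies the boundary condition at \<open>0\<close>,
  \<open>r5\<close> that at \<open>1\<close>, and \<open>r6 0\<close> is their Wronskian.
\<close>

definition Neumann_kernel :: "(real \<Rightarrow> real) \<Rightarrow> (real \<Rightarrow> real) \<Rightarrow> real \<Rightarrow> real \<Rightarrow> real" where
  "Neumann_kernel r5 r6 t s = r6 (min t s) * r5 (max t s) / r6 0"

lemma continuous_on_Neumann_kernel:
  assumes "is_r5 a lam r5" "is_r6 a lam r6" and t: "t \<in> {0..1}"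
  shows "continuous_on {0..1} (Neumann_kernel r5 r6 t)"
proof -
  have r5: "continuous_on {0..1} r5" and r6: "continuous_on {0..1} r6"
    using assms by (simp_all add: is_r5_def is_r6_def W21_continuous_on)
  have "continuous_on {0..1} (\<lambda>s. r6 (min t s) * r5 (max t s) * inverse (r6 0))"
    using t by (intro continuous_intros continuous_on_compose2[OF r5] continuous_on_compose2[OF r6]) auto
  then show ?thesis unfolding Neumann_kernel_def by (simp add: divide_inverse)
qed

text \<open>
  The Lagrange identity with \<open>r6\<close> on \<open>[0,t]\<close> and with \<open>r5\<close> on \<open>[t,1]\<close> gives two equations that involve
  \<open>u t\<close> and \<open>u' t\<close>.  Multiplied by \<open>r5 t\<close> and \<open>r6 t\<close> and added, they no longer contain \<open>u' t\<close>, and the coefficient of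
  \<open>u t\<close> is the Wronskian.  The boundary derivatives of \<open>u\<close> enter as coefficients,
  so that the formula serves the Neumann and the Dirichlet problem alike.
\<close>

lemma Neumann_representation:
  assumes r5: "is_r5 a lam r5" and r6: "is_r6 a lam r6" and W: "r6 0 \<noteq> 0"
    and u: "u \<in> W21" and Lu: "L_eq_ae a lam u \<sigma>" and t: "t \<in> {0..1}"
  shows "((\<lambda>s. Neumann_kernel r5 r6 t s * \<sigma> s) has_integral
      u t - deriv_I u 0 * r5 t - deriv_I u 1 * r6 t) {0..1}"
proof -
  have r5': "r5 \<in> W21" "L_eq_ae a lam r5 (\<lambda>_. 0)" "deriv_I r5 0 = 1" "deriv_I r5 1 = 0"
    and r6': "r6 \<in> W21" "L_eq_ae a lam r6 (\<lambda>_. 0)" "deriv_I r6 0 = 0" "deriv_I r6 1 = 1"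
    using r5 r6 by (simp_all add: is_r5_def is_r6_def)
  define A where "A = deriv_I u t * r6 t - u t * deriv_I r6 t - deriv_I u 0 * r6 0"
  define B where "B = deriv_I u 1 * r5 1 - (deriv_I u t * r5 t - u t * deriv_I r5 t)"
  have "((\<lambda>s. \<sigma> s * r6 s) has_integral A) {0..t}"
    using Lagrange_identity[OF u r6'(1) Lu r6'(2), of 0 t] t by (simp add: A_def r6')
  then have left: "((\<lambda>s. r5 t / r6 0 * (\<sigma> s * r6 s)) has_integral r5 t / r6 0 * A) {0..t}"
    by (rule has_integral_mult_right)
  have "((\<lambda>s. \<sigma> s * r5 s) has_integral B) {t..1}"
    using Lagrange_identity[OF u r5'(1) Lu r5'(2), of t 1] t by (simp add: B_def r5')
  then have right: "((\<lambda>s. r6 t / r6 0 * (\<sigma> s * r5 s)) has_integral r6 t / r6 0 * B) {t..1}"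
    by (rule has_integral_mult_right)
  have "((\<lambda>s. Neumann_kernel r5 r6 t s * \<sigma> s) has_integral r5 t / r6 0 * A + r6 t / r6 0 * B) {0..1}"
  proof (rule has_integral_combine[of 0 t 1])
    show "((\<lambda>s. Neumann_kernel r5 r6 t s * \<sigma> s) has_integral r5 t / r6 0 * A) {0..t}"
      by (rule has_integral_eq[OF _ left]) (simp add: Neumann_kernel_def max_absorb1)
    show "((\<lambda>s. Neumann_kernel r5 r6 t s * \<sigma> s) has_integral r6 t / r6 0 * B) {t..1}"
      by (rule has_integral_eq[OF _ right]) (simp add: Neumann_kernel_def)
  qed (use t in auto)
  moreover have "r5 t / r6 0 * A + r6 t / r6 0 * B = u t - deriv_I u 0 * r5 t - deriv_I u 1 * r6 t"
  proof -
    have "r5 t * A + r6 t * B = u t * (deriv_I r5 t * r6 t - r5 t * deriv_I r6 t)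
        - deriv_I u 0 * r6 0 * r5 t + deriv_I u 1 * r5 1 * r6 t"
      by (simp add: A_def B_def algebra_simps)
    also have "\<dots> = r6 0 * (u t - deriv_I u 0 * r5 t - deriv_I u 1 * r6 t)"
      unfolding Wronskian_r6_r5[OF r5 r6 t] r5_1_eq[OF r5 r6] by (simp add: algebra_simps)
    finally show ?thesis using W by (simp add: field_simps)
  qed
  ultimately show ?thesis by simp
qed

section \<open>Identification of Green's functions and of their boundary derivatives\<close>

text \<open>
  The difference \<open>G t - K\<close> of two continuous functions integrates to zero against every integrable
  \<open>\<sigma>\<close>; the choice \<open>\<sigma> = G t - K\<close> shows that it vanishes.
\<close>

lemma Green_function_eq_kernel:
  assumes G: "is_Green_function a lam X G" and t: "t \<in> {0..1}" and s: "s \<in> {0..1}"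
    and K: "continuous_on {0..1} K"
    and repr: "\<And>u \<sigma>. \<lbrakk>u \<in> X; L_eq_ae a lam u \<sigma>\<rbrakk> \<Longrightarrow> ((\<lambda>s. K s * \<sigma> s) has_integral u t) {0..1}"
  shows "G t s = K s"
proof -
  have "continuous_on ({0..1} \<times> {0..1}) (\<lambda>(t, s). G t s)"
    using G by (simp add: is_Green_function_def)
  then have "continuous_on {0..1} (\<lambda>s. (\<lambda>(t, s). G t s) (t, s))"
    by (rule continuous_on_compose2) (use t in \<open>auto intro!: continuous_intros\<close>)
  then have Gt: "continuous_on {0..1} (G t)" by simp
  define \<sigma> where "\<sigma> s = G t s - K s" for s
  have \<sigma>: "continuous_on {0..1} \<sigma>"
    unfolding \<sigma>_def by (intro continuous_intros Gt K)
  define u where "u t = (LINT s|lebesgue_on {0..1}. G t s * \<sigma> s)" for t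
  have "integrable (lebesgue_on {0..1}) \<sigma>" using \<sigma> by (rule continuous_imp_integrable_real)
  then have "u \<in> X" "L_eq_ae a lam u \<sigma>"
    using G unfolding is_Green_function_def u_def by blast+
  then have 1: "((\<lambda>s. K s * \<sigma> s) has_integral u t) {0..1}" by (rule repr)
  have 2: "((\<lambda>s. G t s * \<sigma> s) has_integral u t) {0..1}"
    unfolding u_def using Gt \<sigma>
    by (intro has_integral_integral_lebesgue_on continuous_imp_integrable_real continuous_intros) auto
  have "((\<lambda>s. \<sigma> s * \<sigma> s) has_integral 0) {0..1}"
    using has_integral_diff[OF 2 1] by (simp add: \<sigma>_def left_diff_distrib)
  then have "\<sigma> s * \<sigma> s = 0"
    using has_integral_0_cbox_imp_0[of 0 1 "\<lambda>s. \<sigma> s * \<sigma> s" s] \<sigma> s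
    by (auto intro!: continuous_intros)
  then show ?thesis by (simp add: \<sigma>_def)
qed

text \<open>
  A formula for the boundary derivative with a right-hand side continuous on \<open>[0,1]\<close> persists at the
  end points, because the value there is defined as a limit.
\<close>

lemma dt_boundary_eqI:
  assumes h: "continuous_on {0..1} h" and s: "s \<in> {0..1}"
    and eq: "\<And>s'. s' \<in> {0<..<1} \<Longrightarrow> deriv_I (\<lambda>t. G t s') t0 = h s'"
  shows "dt_boundary G t0 s = h s"
proof (cases "s \<in> {0<..<1}")
  case True
  then show ?thesis by (simp add: dt_boundary_def eq)
next
  case False
  then have "s = 0 \<or> s = 1" using s by auto
  then have nontriv: "at s within {0<..<1} \<noteq> bot"
    using islimpt_greaterThanLessThan1[of 0 "1::real"] islimpt_greaterThanLessThan2[of 0 "1::real"]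
    by (auto simp: trivial_limit_within)
  have "(h \<longlongrightarrow> h s) (at s within {0..1})" using h s by (simp add: continuous_on_def)
  then have "(h \<longlongrightarrow> h s) (at s within {0<..<1})" by (rule tendsto_within_subset) auto
  then have "((\<lambda>s'. deriv_I (\<lambda>t. G t s') t0) \<longlongrightarrow> h s) (at s within {0<..<1})"
    by (rule Lim_transform_within[OF _ zero_less_one]) (simp add: eq)
  from tendsto_Lim[OF nontriv this] show ?thesis
    using False by (simp only: dt_boundary_def if_False)
qed

section \<open>The Dirichlet Green's function in terms of the Neumann one\<close>

theorem theorem3p15:
  fixes a :: "real \<Rightarrow> real" and lam :: real
    and G\<^sub>D G\<^sub>N :: "real \<Rightarrow> real \<Rightarrow> real" and r\<^sub>5 r\<^sub>6 :: "real \<Rightarrow> real"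
  assumes "integrable (lebesgue_on {0..1}) a"
    and "nonresonant a lam X_D" and "nonresonant a lam X_N"
    and "is_Green_function a lam X_D G\<^sub>D" and "is_Green_function a lam X_N G\<^sub>N"
    and "is_r5 a lam r\<^sub>5" and "is_r6 a lam r\<^sub>6"
  shows "\<forall>t\<in>{0..1}. \<forall>s\<in>{0..1}.
      G\<^sub>D t s = G\<^sub>N t s + r\<^sub>5 t * dt_boundary G\<^sub>D 0 s + r\<^sub>6 t * dt_boundary G\<^sub>D 1 s \<and>
      G\<^sub>N t s + r\<^sub>5 t * dt_boundary G\<^sub>D 0 s + r\<^sub>6 t * dt_boundary G\<^sub>D 1 s =
      G\<^sub>N t s + G\<^sub>N t 0 * dt_boundary G\<^sub>D 0 s - G\<^sub>N t 1 * dt_boundary G\<^sub>D 1 s"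
proof -
  note r5 = \<open>is_r5 a lam r\<^sub>5\<close> and r6 = \<open>is_r6 a lam r\<^sub>6\<close>
  have r5': "r\<^sub>5 \<in> W21" "L_eq_ae a lam r\<^sub>5 (\<lambda>_. 0)" "deriv_I r\<^sub>5 0 = 1" "deriv_I r\<^sub>5 1 = 0"
    and r6': "r\<^sub>6 \<in> W21" "L_eq_ae a lam r\<^sub>6 (\<lambda>_. 0)" "deriv_I r\<^sub>6 0 = 0" "deriv_I r\<^sub>6 1 = 1"
    using r5 r6 by (simp_all add: is_r5_def is_r6_def)
  have W: "r\<^sub>6 0 \<noteq> 0" by (rule r6_0_nonzero[OF assms(1) r6])
  let ?K = "Neumann_kernel r\<^sub>5 r\<^sub>6"
  define D where "D = r\<^sub>5 0 * r\<^sub>6 1 - r\<^sub>6 0 * r\<^sub>5 1"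
  \<comment> \<open>Otherwise the following \<open>v\<close> is in \<open>X_D\<close>, hence zero, while \<open>v' 1 = - r5 1 = r6 0\<close>.\<close>
  have "D \<noteq> 0"
  proof
    assume "D = 0"
    define v where "v t = r\<^sub>6 1 * r\<^sub>5 t + (- r\<^sub>5 1) * r\<^sub>6 t" for t
    have v': "deriv_I v t = r\<^sub>6 1 * deriv_I r\<^sub>5 t + (- r\<^sub>5 1) * deriv_I r\<^sub>6 t" if "t \<in> {0..1}" for t
      unfolding v_def by (rule deriv_I_linear_combination[OF r5'(1) r6'(1) that])
    have "v \<in> W21" "L_eq_ae a lam v (\<lambda>_. 0)"
      unfolding v_def
      by (rule W21_linear_combination[OF r5'(1) r6'(1)],
          rule L_eq_ae_linear_combination[OF r5'(1) r6'(1) r5'(2) r6'(2)])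
    moreover have "v 0 = 0" "v 1 = 0" using \<open>D = 0\<close> by (simp_all add: v_def D_def algebra_simps)
    ultimately have "\<forall>t\<in>{0..1}. v t = 0"
      using assms(2) by (simp add: nonresonant_def X_D_def)
    then have "(v has_real_derivative 0) (at 1 within {0..1})"
      by (intro has_field_derivative_transform_within[OF DERIV_const zero_less_one]) auto
    then have "deriv_I v 1 = 0" by (rule deriv_I_eqI) simp
    then have "r\<^sub>5 1 = 0" using v'[of 1] r5' r6' by simp
    then show False using r5_1_eq[OF r5 r6] W by simp
  qed
  \<comment> \<open>The solutions of the homogeneous equation with Dirichlet data \<open>(1, 0)\<close> and \<open>(0, 1)\<close>.\<close>
  define \<psi> where "\<psi> t = r\<^sub>6 1 / D * r\<^sub>5 t + (- r\<^sub>5 1 / D) * r\<^sub>6 t" for t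
  define \<phi> where "\<phi> t = (- r\<^sub>6 0 / D) * r\<^sub>5 t + r\<^sub>5 0 / D * r\<^sub>6 t" for t
  have \<psi>: "\<psi> \<in> W21" "L_eq_ae a lam \<psi> (\<lambda>_. 0)" and \<phi>: "\<phi> \<in> W21" "L_eq_ae a lam \<phi> (\<lambda>_. 0)"
    unfolding \<psi>_def \<phi>_def
    by (intro W21_linear_combination L_eq_ae_linear_combination r5' r6')+
  have bdry: "\<psi> 0 = 1" "\<psi> 1 = 0" "\<phi> 0 = 0" "\<phi> 1 = 1"
    using \<open>D \<noteq> 0\<close> by (simp_all add: \<psi>_def \<phi>_def field_simps) (simp_all add: D_def algebra_simps)
  have GN: "G\<^sub>N t s = ?K t s" if "t \<in> {0..1}" "s \<in> {0..1}" for t s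
  proof (rule Green_function_eq_kernel[OF assms(5) that continuous_on_Neumann_kernel[OF r5 r6 that(1)]])
    fix u \<sigma> assume "u \<in> X_N" "L_eq_ae a lam u \<sigma>"
    then show "((\<lambda>s. ?K t s * \<sigma> s) has_integral u t) {0..1}"
      using Neumann_representation[OF r5 r6 W, of u \<sigma> t] that(1) by (simp add: X_N_def)
  qed
  have GD: "G\<^sub>D t s = ?K t s - r\<^sub>5 t * \<psi> s + r\<^sub>6 t * \<phi> s" if "t \<in> {0..1}" "s \<in> {0..1}" for t s
  proof (rule Green_function_eq_kernel[OF assms(4) that])
    show "continuous_on {0..1} (\<lambda>s. ?K t s - r\<^sub>5 t * \<psi> s + r\<^sub>6 t * \<phi> s)"
      by (intro continuous_intros continuous_on_Neumann_kernel[OF r5 r6 that(1)]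
          W21_continuous_on \<psi> \<phi>)
    fix u \<sigma> assume "u \<in> X_D" and Lu: "L_eq_ae a lam u \<sigma>"
    then have u: "u \<in> W21" "u 0 = 0" "u 1 = 0" by (simp_all add: X_D_def)
    \<comment> \<open>For \<open>u \<in> X_D\<close> the boundary derivatives are moments of \<open>\<sigma>\<close>, and they can be
      inserted into the Neumann representation of \<open>u\<close>.\<close>
    have I\<psi>: "((\<lambda>s. \<sigma> s * \<psi> s) has_integral - deriv_I u 0) {0..1}"
      using Lagrange_identity[OF u(1) \<psi>(1) Lu \<psi>(2), of 0 1] by (simp add: u bdry)
    have I\<phi>: "((\<lambda>s. \<sigma> s * \<phi> s) has_integral deriv_I u 1) {0..1}"
      using Lagrange_identity[OF u(1) \<phi>(1) Lu \<phi>(2), of 0 1] by (simp add: u bdry)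
    have "((\<lambda>s. ?K t s * \<sigma> s - r\<^sub>5 t * (\<sigma> s * \<psi> s) + r\<^sub>6 t * (\<sigma> s * \<phi> s)) has_integral
        (u t - deriv_I u 0 * r\<^sub>5 t - deriv_I u 1 * r\<^sub>6 t) - r\<^sub>5 t * (- deriv_I u 0)
        + r\<^sub>6 t * deriv_I u 1) {0..1}"
      by (intro has_integral_add has_integral_diff has_integral_mult_right I\<psi> I\<phi>
          Neumann_representation[OF r5 r6 W u(1) Lu that(1)])
    then show "((\<lambda>s. (?K t s - r\<^sub>5 t * \<psi> s + r\<^sub>6 t * \<phi> s) * \<sigma> s) has_integral u t) {0..1}"
      by (simp add: algebra_simps)
  qed
  have dt0: "dt_boundary G\<^sub>D 0 s = - \<psi> s" if "s \<in> {0..1}" for s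
  proof (rule dt_boundary_eqI[OF _ that])
    show "continuous_on {0..1} (\<lambda>s. - \<psi> s)" by (intro continuous_intros W21_continuous_on \<psi>)
    fix s :: real assume s: "s \<in> {0<..<1}"
    \<comment> \<open>Near \<open>t = 0\<close>, namely for \<open>t < s\<close>, the kernel depends on \<open>t\<close> only through \<open>r6 t\<close>.\<close>
    have "((\<lambda>t. r\<^sub>6 t * (r\<^sub>5 s / r\<^sub>6 0) - r\<^sub>5 t * \<psi> s + r\<^sub>6 t * \<phi> s) has_real_derivative
        deriv_I r\<^sub>6 0 * (r\<^sub>5 s / r\<^sub>6 0) - deriv_I r\<^sub>5 0 * \<psi> s + deriv_I r\<^sub>6 0 * \<phi> s) (at 0 within {0..1})"
      by (intro DERIV_add DERIV_diff DERIV_cmult_right has_real_derivative_deriv_I r5' r6') auto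
    then have "((\<lambda>t. G\<^sub>D t s) has_real_derivative
        deriv_I r\<^sub>6 0 * (r\<^sub>5 s / r\<^sub>6 0) - deriv_I r\<^sub>5 0 * \<psi> s + deriv_I r\<^sub>6 0 * \<phi> s) (at 0 within {0..1})"
      by (rule has_field_derivative_transform_within[where d = s])
        (use s in \<open>auto simp: GD Neumann_kernel_def dist_real_def min_def max_def\<close>)
    then have "deriv_I (\<lambda>t. G\<^sub>D t s) 0
        = deriv_I r\<^sub>6 0 * (r\<^sub>5 s / r\<^sub>6 0) - deriv_I r\<^sub>5 0 * \<psi> s + deriv_I r\<^sub>6 0 * \<phi> s"
      by (rule deriv_I_eqI) simp
    then show "deriv_I (\<lambda>t. G\<^sub>D t s) 0 = - \<psi> s" by (simp add: r5' r6')
  qed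
  have dt1: "dt_boundary G\<^sub>D 1 s = \<phi> s" if "s \<in> {0..1}" for s
  proof (rule dt_boundary_eqI[OF _ that])
    show "continuous_on {0..1} \<phi>" by (intro W21_continuous_on \<phi>)
    fix s :: real assume s: "s \<in> {0<..<1}"
    \<comment> \<open>Near \<open>t = 1\<close>, namely for \<open>t > s\<close>, the kernel depends on \<open>t\<close> only through \<open>r5 t\<close>.\<close>
    have "((\<lambda>t. r\<^sub>5 t * (r\<^sub>6 s / r\<^sub>6 0) - r\<^sub>5 t * \<psi> s + r\<^sub>6 t * \<phi> s) has_real_derivative
        deriv_I r\<^sub>5 1 * (r\<^sub>6 s / r\<^sub>6 0) - deriv_I r\<^sub>5 1 * \<psi> s + deriv_I r\<^sub>6 1 * \<phi> s) (at 1 within {0..1})"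
      by (intro DERIV_add DERIV_diff DERIV_cmult_right has_real_derivative_deriv_I r5' r6') auto
    then have "((\<lambda>t. G\<^sub>D t s) has_real_derivative
        deriv_I r\<^sub>5 1 * (r\<^sub>6 s / r\<^sub>6 0) - deriv_I r\<^sub>5 1 * \<psi> s + deriv_I r\<^sub>6 1 * \<phi> s) (at 1 within {0..1})"
      by (rule has_field_derivative_transform_within[where d = "1 - s"])
        (use s in \<open>auto simp: GD Neumann_kernel_def dist_real_def min_def max_def\<close>)
    then have "deriv_I (\<lambda>t. G\<^sub>D t s) 1
        = deriv_I r\<^sub>5 1 * (r\<^sub>6 s / r\<^sub>6 0) - deriv_I r\<^sub>5 1 * \<psi> s + deriv_I r\<^sub>6 1 * \<phi> s"
      by (rule deriv_I_eqI) simp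
    then show "deriv_I (\<lambda>t. G\<^sub>D t s) 1 = \<phi> s" by (simp add: r5' r6')
  qed
  have GN0: "G\<^sub>N t 0 = r\<^sub>5 t" and GN1: "G\<^sub>N t 1 = - r\<^sub>6 t" if "t \<in> {0..1}" for t
    using that W r5_1_eq[OF r5 r6] by (simp_all add: GN Neumann_kernel_def)
  show ?thesis
  proof (intro ballI)
    fix t s :: real assume t: "t \<in> {0..1}" and s: "s \<in> {0..1}"
    show "G\<^sub>D t s = G\<^sub>N t s + r\<^sub>5 t * dt_boundary G\<^sub>D 0 s + r\<^sub>6 t * dt_boundary G\<^sub>D 1 s \<and>
      G\<^sub>N t s + r\<^sub>5 t * dt_boundary G\<^sub>D 0 s + r\<^sub>6 t * dt_boundary G\<^sub>D 1 s =
      G\<^sub>N t s + G\<^sub>N t 0 * dt_boundary G\<^sub>D 0 s - G\<^sub>N t 1 * dt_boundary G\<^sub>D 1 s"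
      by (simp add: GD[OF t s] GN[OF t s] dt0[OF s] dt1[OF s] GN0[OF t] GN1[OF t])
  qed
qed

end
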